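(* Let $p>1$ and let $(S(t))_{t\ge0}$ be a strongly continuous semigroup (with $S(0)=I$) on a complex reflexive Banach space $\mathcal B\neq\{0\}$ such that $\|S(t)\|\le1$ for all $t\ge0$ and $\hat r_p(0)>0$. Then $$\|S(t)\|\le e^{-\hat r_p(0)\,t+\frac\pi2}\qquad\text{for all }t\ge0.$$
   Context: Here $1<p<\infty$ and $\|S(t)\|$ is the operator norm on $\mathcal L(\mathcal B)$. For $u\in L^p(\mathbb R_+;\mathcal B)$ set $(\mathcal K^+u)(t)=\int_0^tS(t-s)u(s)\,ds$, $t\ge0$. Let $K_{0,p}:=\|\mathcal K^+\|_{\mathcal L(L^p(\mathbb R_+;\mathcal B))}\in\,]0,+\infty]$ and $\hat r_p(0):=1/K_{0,p}$; thus $\hat r_p(0)>0$ means that $\mathcal K^+$ is a bounded operator on $L^p(\mathbb R_+;\mathcal B)$. *)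

theory Defs
  imports "HOL-Analysis.Analysis"
begin

text \<open>
  The distribution only has real normed spaces. A complex Banach space is a real one (class
  \<^class>\<open>banach\<close>) with a compatible complex scalar multiplication, so the sort used in
  theorems is \<open>{complex_normed_vector, banach}\<close>.
\<close>

class complex_normed_vector = real_normed_vector +
  fixes scaleC :: "complex \<Rightarrow> 'a \<Rightarrow> 'a"  (infixr \<open>*\<^sub>C\<close> 75)
  assumes scaleC_add_right: "c *\<^sub>C (x + y) = c *\<^sub>C x + c *\<^sub>C y"
    and scaleC_add_left: "(c + d) *\<^sub>C x = c *\<^sub>C x + d *\<^sub>C x"
    and scaleC_scaleC: "c *\<^sub>C (d *\<^sub>C x) = (c * d) *\<^sub>C x"
    and scaleC_one: "1 *\<^sub>C x = x"
    and scaleR_scaleC: "r *\<^sub>R x = complex_of_real r *\<^sub>C x"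
    and norm_scaleC: "norm (c *\<^sub>C x) = cmod c * norm x"

text \<open>
  Bounded complex-linear maps are the elements of the library type of bounded real-linear maps that
  commute with complex scalars; the norm of that type is the supremum of \<open>norm (f x) / norm x\<close>,
  so it is also their operator norm over the complex numbers.
\<close>

definition complex_dual :: "('a::complex_normed_vector \<Rightarrow>\<^sub>L complex) set" where
  "complex_dual = {f. \<forall>c x. blinfun_apply f (c *\<^sub>C x) = c * blinfun_apply f x}"

text \<open>
  \<open>\<phi>\<close> is a bounded linear functional on the dual; only its values on \<^const>\<open>complex_dual\<close>
  matter.
\<close>

definition bidual_functional :: "(('a::complex_normed_vector \<Rightarrow>\<^sub>L complex) \<Rightarrow> complex) \<Rightarrow> bool" where
  "bidual_functional \<phi> \<longleftrightarrow>
     (\<forall>f\<in>complex_dual. \<forall>g\<in>complex_dual. \<phi> (f + g) = \<phi> f + \<phi> g) \<and>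
     (\<forall>c. \<forall>f\<in>complex_dual. \<phi> (blinfun_mult_right c o\<^sub>L f) = c * \<phi> f) \<and>
     (\<exists>C. \<forall>f\<in>complex_dual. cmod (\<phi> f) \<le> C * norm f)"

text \<open>Reflexivity: the canonical embedding into the bidual is surjective.\<close>

definition reflexive_space :: "'a::complex_normed_vector itself \<Rightarrow> bool" where
  "reflexive_space _ \<longleftrightarrow>
     (\<forall>\<phi> :: ('a \<Rightarrow>\<^sub>L complex) \<Rightarrow> complex. bidual_functional \<phi> \<longrightarrow>
        (\<exists>x::'a. \<forall>f\<in>complex_dual. \<phi> f = blinfun_apply f x))"

text \<open>Only the values \<open>S t\<close> with \<open>t \<ge> 0\<close> matter.\<close>

definition C0_semigroup :: "(real \<Rightarrow> ('a::complex_normed_vector \<Rightarrow>\<^sub>L 'a)) \<Rightarrow> bool" where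
  "C0_semigroup S \<longleftrightarrow>
     (\<forall>t\<ge>0. \<forall>c x. blinfun_apply (S t) (c *\<^sub>C x) = c *\<^sub>C blinfun_apply (S t) x) \<and>
     S 0 = id_blinfun \<and>
     (\<forall>s\<ge>0. \<forall>t\<ge>0. S (s + t) = S s o\<^sub>L S t) \<and>
     (\<forall>x. continuous_on {0..} (\<lambda>t. blinfun_apply (S t) x))"

text \<open>
  The library's Bochner integral is restricted to second countable codomains, which would exclude
  nonseparable Banach spaces. The next three definitions repeat it with strong measurability in place
  of Borel measurability, without that restriction.
\<close>

definition strongly_measurable :: "'b measure \<Rightarrow> ('b \<Rightarrow> 'a::real_normed_vector) \<Rightarrow> bool" where
  "strongly_measurable M f \<longleftrightarrow>
     (\<exists>s :: nat \<Rightarrow> 'b \<Rightarrow> 'a. (\<forall>i. simple_function M (s i)) \<and>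
        (AE x in M. (\<lambda>i. s i x) \<longlonglongrightarrow> f x))"

definition has_strong_bochner_integral ::
    "'b measure \<Rightarrow> ('b \<Rightarrow> 'a::real_normed_vector) \<Rightarrow> 'a \<Rightarrow> bool" where
  "has_strong_bochner_integral M f x \<longleftrightarrow>
     strongly_measurable M f \<and>
     (\<exists>s :: nat \<Rightarrow> 'b \<Rightarrow> 'a. (\<forall>i. Bochner_Integration.simple_bochner_integrable M (s i)) \<and>
        (\<lambda>i. \<integral>\<^sup>+ y. ennreal (norm (f y - s i y)) \<partial>M) \<longlonglongrightarrow> 0 \<and>
        (\<lambda>i. Bochner_Integration.simple_bochner_integral M (s i)) \<longlonglongrightarrow> x)"

definition strong_bochner_integral :: "'b measure \<Rightarrow> ('b \<Rightarrow> 'a::real_normed_vector) \<Rightarrow> 'a" where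
  "strong_bochner_integral M f =
     (if \<exists>x. has_strong_bochner_integral M f x
      then THE x. has_strong_bochner_integral M f x else 0)"

text \<open>
  The norm of \<open>L\<^sup>p(\<real>\<^sub>+; 'a)\<close>, with value \<open>\<infinity>\<close> if the integral diverges. Elements of the space are
  represented by functions on \<^typ>\<open>real\<close>, whose values on negative arguments are ignored.
\<close>

definition Lp_norm :: "real \<Rightarrow> (real \<Rightarrow> 'a::real_normed_vector) \<Rightarrow> ennreal" where
  "Lp_norm p u =
     (let I = \<integral>\<^sup>+ t. ennreal (norm (u t) powr p) \<partial>lebesgue_on {0..}
      in if I = \<infinity> then \<infinity> else ennreal (enn2real I powr (1 / p)))"

definition Lp_space :: "real \<Rightarrow> (real \<Rightarrow> 'a::real_normed_vector) set" where
  "Lp_space p = {u. strongly_measurable (lebesgue_on {0..}) u \<and> Lp_norm p u < \<infinity>}"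

definition K_plus ::
    "(real \<Rightarrow> ('a::real_normed_vector \<Rightarrow>\<^sub>L 'a)) \<Rightarrow> (real \<Rightarrow> 'a) \<Rightarrow> real \<Rightarrow> 'a" where
  "K_plus S u t =
     strong_bochner_integral (lebesgue_on {0..t}) (\<lambda>s. blinfun_apply (S (t - s)) (u s))"

text \<open>
  The operator norm of \<^const>\<open>K_plus\<close> on \<open>L\<^sup>p\<close>; it is \<open>\<infinity>\<close> (infimum of the empty set) if
  \<^const>\<open>K_plus\<close> is not a bounded operator from \<open>L\<^sup>p\<close> to itself.
\<close>

definition K_norm :: "real \<Rightarrow> (real \<Rightarrow> ('a::real_normed_vector \<Rightarrow>\<^sub>L 'a)) \<Rightarrow> ennreal" where
  "K_norm p S =
     Inf {C. C < \<infinity> \<and>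
       (\<forall>u\<in>Lp_space p. K_plus S u \<in> Lp_space p \<and> Lp_norm p (K_plus S u) \<le> C * Lp_norm p u)}"

text \<open>
  In \<^typ>\<open>ennreal\<close>, \<open>1 / \<infinity> = 0\<close>. On a nonzero space \<^const>\<open>K_norm\<close> is positive, hence this value
  is finite.
\<close>

definition r_hat :: "real \<Rightarrow> (real \<Rightarrow> ('a::real_normed_vector \<Rightarrow>\<^sub>L 'a)) \<Rightarrow> ennreal" where
  "r_hat p S = 1 / K_norm p S"

end

theory Submission
  imports Defs
begin

text \<open>
  Fix \<open>x\<close> and let \<open>f t = norm (S t x)\<close>, a nonincreasing function. If \<open>\<phi>\<close> vanishes at \<open>0\<close> and
  \<open>u s = \<phi>' s *\<^sub>R S s x\<close> on \<open>[0, T]\<close>, then \<open>K_plus S u t = \<phi> t *\<^sub>R S t x\<close> there, so a bound \<open>c\<close>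
  for the norm of the convolution operator gives \<open>\<integral> \<phi>\<^sup>p f\<^sup>p \<le> \<integral> (c \<phi>')\<^sup>p f\<^sup>p\<close> over \<open>[0, T]\<close>.
  Take for \<open>\<phi>\<close> a generalized sine until \<open>c \<phi>' = \<phi>\<close>, then an exponential of rate \<open>1 / c\<close>, then
  a generalized sine again until \<open>\<phi>' = 0\<close> at \<open>T\<close>. The exponential piece contributes nothing, and
  bounding \<open>f\<close> by \<open>f 0\<close> on the first piece and from below by \<open>f T\<close> on the last one yields
  \<open>f T \<le> f 0 * exp (- T / c + a + b)\<close>, where \<open>a\<close> and \<open>b\<close> are the durations of the two sine
  pieces in units of \<open>c\<close>. Finally \<open>a + b \<le> \<pi> / 2\<close>, with equality for \<open>p = 2\<close>.
\<close>

section \<open>A hyperbolic inequality and the comparison of conjugate integrands\<close>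

text \<open>The difference \<open>y\<close> of the two sides satisfies
  \<open>y'' - m\<^sup>2 * y = 2 * m * d * cosh t * sinh (d * t)\<close>, which is nonnegative for
  \<open>t \<ge> 0\<close>, and both \<open>y\<close> and its derivative vanish at 0. Factoring the
  operator into two first-order ones and using the integrating factors
  \<open>exp (- (m * t))\<close> and \<open>exp (m * t)\<close> gives first
  \<open>y' + m * y \<ge> 0\<close>, then \<open>y \<ge> 0\<close>.\<close>

lemma sinh_le_mult_sinh_cosh:
  fixes m d t :: real
  assumes m: "m > 0" "m\<^sup>2 = 1 + d\<^sup>2" and t: "0 \<le> t"
  shows "sinh (m * t) \<le> m * (sinh t * cosh (d * t))"
proof -
  define y where "y t = m * (sinh t * cosh (d * t)) - sinh (m * t)" for t
  define y' where "y' t = m * (cosh t * cosh (d * t) + d * (sinh t * sinh (d * t))) - m * cosh (m * t)" for t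
  have dy: "(y has_real_derivative y' t) (at t)" for t
    unfolding y_def y'_def by (auto intro!: derivative_eq_intros simp: algebra_simps)
  define g where "g t = (y' t + m * y t) * exp (- (m * t))" for t
  have dg: "(g has_real_derivative 2 * m * d * (cosh t * sinh (d * t)) * exp (- (m * t))) (at t)" for t
  proof -
    have "(y' has_real_derivative m * ((1 + d\<^sup>2) * (sinh t * cosh (d * t)) + 2 * d * (cosh t * sinh (d * t)))
        - m\<^sup>2 * sinh (m * t)) (at t)"
      unfolding y'_def by (auto intro!: derivative_eq_intros simp: algebra_simps power2_eq_square)
    from this[folded m(2)] show ?thesis unfolding g_def
      by (auto intro!: derivative_eq_intros dy)
        (simp add: y_def y'_def algebra_simps power2_eq_square)
  qed
  have "g t \<ge> g 0" if "0 \<le> t" for t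
  proof (rule DERIV_nonneg_imp_nondecreasing[OF that])
    fix s :: real assume s: "0 \<le> s"
    have "d * sinh (d * s) \<ge> 0"
      using s by (cases "d \<ge> 0") (auto simp: zero_le_mult_iff mult_nonpos_nonneg mult_le_0_iff)
    hence "0 \<le> 2 * m * d * (cosh s * sinh (d * s)) * exp (- (m * s))"
      using mult_nonneg_nonneg[of "2 * m * cosh s * exp (- (m * s))" "d * sinh (d * s)"] m(1)
      by (simp add: mult_ac)
    then show "\<exists>y. (g has_real_derivative y) (at s) \<and> 0 \<le> y" using dg by blast
  qed
  then have g: "y' t + m * y t \<ge> 0" if "0 \<le> t" for t
    using that by (force simp: g_def y_def y'_def zero_le_mult_iff)
  have "y 0 * exp (m * 0) \<le> y t * exp (m * t)"
  proof (rule DERIV_nonneg_imp_nondecreasing[OF t])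
    fix s :: real assume s: "0 \<le> s"
    have "((\<lambda>s. y s * exp (m * s)) has_real_derivative (y' s + m * y s) * exp (m * s)) (at s)"
      by (auto intro!: derivative_eq_intros dy simp: algebra_simps)
    then show "\<exists>D. ((\<lambda>s. y s * exp (m * s)) has_real_derivative D) (at s) \<and> 0 \<le> D"
      using g[OF s] by (metis exp_ge_zero mult_nonneg_nonneg)
  qed
  then show ?thesis by (simp add: y_def zero_le_mult_iff)
qed

text \<open>
  Here \<open>k\<close> plays the role of \<open>p - 1\<close>, so \<open>1 + 1 / k\<close> and \<open>1 + k\<close> are conjugate exponents. Writing
  \<open>w = exp (- t)\<close>, \<open>k = m + d\<close> and \<open>1 / k = m - d\<close> reduces the inequality to the preceding lemma.
\<close>

lemma conjugate_inverse_sum_le: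
  fixes k w :: real
  assumes k: "k > 0" and w: "0 \<le> w" "w \<le> 1"
  shows "1 / (1 + k * w powr (1 + 1 / k)) + 1 / (1 + w powr (1 + k) / k) \<le> 2 / (1 + w\<^sup>2)"
proof (cases "w = 0")
  case False
  with w have w0: "w > 0" by simp
  define t where "t = - ln w"
  define m where "m = (k + 1 / k) / 2"
  define d where "d = (k - 1 / k) / 2"
  have t: "0 \<le> t" using w w0 by (simp add: t_def)
  have wt: "w = exp (- t)" using w0 by (simp add: t_def)
  have md: "m > 0" "m\<^sup>2 = 1 + d\<^sup>2" using k by (auto simp: m_def d_def field_simps power2_eq_square intro!: add_pos_pos)
  have kmd: "k = m + d" "1 / k = m - d" by (auto simp: m_def d_def field_simps)
  define A where "A = k * w powr (1 + 1 / k)"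
  define B where "B = w powr (1 + k) / k"
  have A: "A = (m + d) * exp (- ((1 + m) * t)) * exp (d * t)"
    unfolding A_def kmd(2) using w0 kmd(1) by (simp add: powr_def t_def exp_add [symmetric] algebra_simps)
  have B: "B = (m - d) * exp (- ((1 + m) * t)) * exp (- (d * t))"
    unfolding B_def kmd(2)[symmetric] using w0 kmd(1) by (simp add: powr_def t_def exp_add [symmetric] algebra_simps)
  have AB: "A * B = exp (- ((2 + 2 * m) * t))"
  proof -
    have "(m + d) * (m - d) = 1" using md(2) by (simp add: power2_eq_square algebra_simps)
    moreover have "A * B = ((m + d) * (m - d)) * (exp (- ((1 + m) * t)) * exp (- ((1 + m) * t))
        * (exp (d * t) * exp (- (d * t))))"
      unfolding A B by (simp add: mult_ac)
    ultimately show ?thesis by (simp add: exp_add[symmetric] algebra_simps)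
  qed
  \<comment> \<open>This is the claim after clearing the denominators \<open>1 + A\<close>,
    \<open>1 + B\<close> and \<open>1 + w\<^sup>2\<close>.\<close>
  have "2 * (w\<^sup>2 - A * B) \<le> (A + B) * (1 - w\<^sup>2)"
  proof -
    have w2: "w\<^sup>2 = exp (- (2 * t))" by (simp add: wt exp_of_nat_mult[symmetric] power2_eq_square exp_add[symmetric])
    have 1: "w\<^sup>2 - A * B = exp (- ((2 + m) * t)) * (2 * sinh (m * t))"
      unfolding AB w2 sinh_def by (simp add: algebra_simps exp_add[symmetric])
    have 2: "1 - w\<^sup>2 = exp (- t) * (2 * sinh t)"
      unfolding w2 sinh_def by (simp add: algebra_simps exp_add[symmetric])
    have 3: "A + B = exp (- ((1 + m) * t)) * (2 * m * cosh (d * t) + 2 * d * sinh (d * t))"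
      unfolding A B sinh_def cosh_def by (simp add: algebra_simps)
    have e: "exp (- ((2 + m) * t)) = exp (- ((1 + m) * t)) * exp (- t)"
      by (simp add: exp_add[symmetric] algebra_simps)
    \<comment> \<open>The sign of \<open>d\<close> is unknown, but \<open>d\<close> and
      \<open>sinh (d * t)\<close> never have opposite signs. This summand from \<open>A + B\<close>
      therefore only helps, and what remains is the hyperbolic inequality.\<close>
    have s: "d * sinh (d * t) * sinh t \<ge> 0"
      using t by (cases "d \<ge> 0") (auto simp: zero_le_mult_iff mult_nonpos_nonneg mult_le_0_iff)
    have "2 * sinh (m * t) \<le> (2 * m * cosh (d * t) + 2 * d * sinh (d * t)) * sinh t"
      using sinh_le_mult_sinh_cosh[OF md t] s by (simp add: algebra_simps)
    then have "4 * sinh (m * t) \<le> 2 * ((2 * m * cosh (d * t) + 2 * d * sinh (d * t)) * sinh t)" by linarith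
    then have "exp (- ((2 + m) * t)) * (4 * sinh (m * t)) \<le>
       exp (- ((2 + m) * t)) * (2 * ((2 * m * cosh (d * t) + 2 * d * sinh (d * t)) * sinh t))"
      by (rule mult_left_mono) simp
    then show ?thesis unfolding 1 2 3 unfolding e by (simp add: algebra_simps)
  qed
  moreover have "A > 0" "B > 0" using k w0 by (auto simp: A_def B_def)
  ultimately have "1 / (1 + A) + 1 / (1 + B) \<le> 2 / (1 + w\<^sup>2)"
    by (simp add: divide_simps add_pos_nonneg) (simp add: algebra_simps)
  then show ?thesis unfolding A_def B_def .
qed (use k in simp)

section \<open>Generalized sines and the sum of their durations\<close>

text \<open>
  \<open>\<sigma>\<close> is the generalized sine, solving the Euler--Lagrange equation of
  \<open>\<integral> \<sigma>'\<^sup>p - \<sigma>\<^sup>p\<close>, and \<open>P\<close> is its derivative. The quotient \<open>\<omega> = \<sigma> / P\<close> is a generalized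
  tangent, \<open>\<omega>' = 1 + \<omega>\<^sup>p / (p - 1)\<close>, obtained as an inverse function; \<open>P\<close> is then recovered from the
  first integral \<open>(p - 1) P\<^sup>p + \<sigma>\<^sup>p = p\<close>.
\<close>

lemma generalized_sine:
  fixes p :: real
  assumes p: "p > 1"
  obtains a \<sigma> P where
    "((\<lambda>w. 1 / (1 + w powr p / (p - 1))) has_integral a) {0..1}" and "0 < a"
    and "continuous_on {0..a} \<sigma>" and "continuous_on {0..a} P"
    and "\<sigma> 0 = 0" and "\<sigma> a = 1" and "P a = 1"
    and "\<And>t. t \<in> {0..a} \<Longrightarrow> 0 \<le> \<sigma> t \<and> \<sigma> t \<le> P t \<and> 0 < P t"
    and "\<And>t. t \<in> {0<..<a} \<Longrightarrow> (\<sigma> has_real_derivative P t) (at t)"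
    and "\<And>t. t \<in> {0<..<a} \<Longrightarrow>
          ((\<lambda>t. P t powr (p - 1)) has_real_derivative - (\<sigma> t powr (p - 1))) (at t)"
    and "((\<lambda>t. P t powr p - \<sigma> t powr p) has_integral 1) {0..a}"
proof -
  define \<kappa> where "\<kappa> w = 1 / (1 + w powr p / (p - 1))" for w
  have pos: "1 + w powr p / (p - 1) > 0" for w :: real
    using p by (simp add: add_pos_nonneg)
  have "continuous_on {0..1} (\<lambda>w. w powr p)"
    using p by (intro continuous_on_powr' continuous_on_id continuous_on_const) auto
  then have "continuous_on {0..1} \<kappa>"
    unfolding \<kappa>_def using p less_imp_neq[OF pos, symmetric]
    by (intro continuous_on_divide continuous_on_add continuous_on_const ballI) auto
  then obtain g where g: "\<And>w. w \<in> {0..1} \<Longrightarrow> (g has_vector_derivative \<kappa> w) (at w within {0..1})"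
    using antiderivative_continuous by blast
  \<comment> \<open>\<open>h w\<close> is the time at which the generalized tangent reaches
    \<open>w\<close>, because \<open>\<kappa>\<close> is the reciprocal of its speed. Thus
    \<open>a\<close> is the time at which it reaches 1, that is, where \<open>\<sigma>\<close> meets
    \<open>P\<close>.\<close>
  define h where "h w = g w - g 0" for w
  define a where "a = h 1"
  have h: "(h has_real_derivative \<kappa> w) (at w within {0..1})" if "w \<in> {0..1}" for w
    unfolding h_def using g[OF that]
    by (auto intro!: derivative_eq_intros simp: has_real_derivative_iff_has_vector_derivative)
  have conth: "continuous_on {0..1} h"
    using h by (meson DERIV_continuous continuous_on_eq_continuous_within)
  have int: "(\<kappa> has_integral h v - h u) {u..v}" if "0 \<le> u" "u \<le> v" "v \<le> 1" for u v
    using that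
    by (intro fundamental_theorem_of_calculus)
      (auto intro!: has_vector_derivative_within_subset[OF h[unfolded has_real_derivative_iff_has_vector_derivative]])
  \<comment> \<open>The bound is the value of \<open>\<kappa>\<close> at 1. A positive lower bound
    makes \<open>h\<close> strictly increasing, hence invertible.\<close>
  have \<kappa>ge: "\<kappa> w \<ge> (p - 1) / p" if "w \<in> {0..1}" for w
  proof -
    have "w powr p \<le> 1" using that p by (simp add: powr_le1)
    then have "w powr p / (p - 1) \<le> 1 / (p - 1)" using p by (intro divide_right_mono) auto
    moreover have "p / (p - 1) = 1 + 1 / (p - 1)" using p by (simp add: field_simps)
    ultimately have "1 + w powr p / (p - 1) \<le> p / (p - 1)" by linarith
    then have "1 / (p / (p - 1)) \<le> \<kappa> w" unfolding \<kappa>_def using pos p by (intro divide_left_mono) auto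
    then show ?thesis by simp
  qed
  have incr: "h u < h v" if "0 \<le> u" "u < v" "v \<le> 1" for u v
  proof -
    have "((\<lambda>_. (p - 1) / p) has_integral (v - u) * ((p - 1) / p)) {u..v}"
      using has_integral_const_real[of "(p - 1) / p" u v] that by simp
    from has_integral_le[OF this int[of u v]] have "(v - u) * ((p - 1) / p) \<le> h v - h u"
      using \<kappa>ge that by auto
    moreover have "(v - u) * ((p - 1) / p) > 0" using that p by simp
    ultimately show ?thesis by linarith
  qed
  have inj: "inj_on h {0..1}"
    by (rule linorder_inj_onI) (use incr in force)+
  have h0: "h 0 = 0" by (simp add: h_def)
  have a0: "a > 0" using incr[of 0 1] by (simp add: h0 a_def)
  have im: "h ` {0..1} = {0..a}"
  proof
    show "h ` {0..1} \<subseteq> {0..a}"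
    proof clarify
      fix w :: real assume w: "w \<in> {0..1}"
      show "h w \<in> {0..a}" using incr[of 0 w] incr[of w 1] w h0 unfolding a_def
        by (cases "w = 0"; cases "w = 1") auto
    qed
    show "{0..a} \<subseteq> h ` {0..1}"
    proof
      fix t assume t: "t \<in> {0..a}"
      then show "t \<in> h ` {0..1}" using IVT'[OF _ _ _ conth, of t] h0 unfolding a_def by auto
    qed
  qed
  define \<omega> where "\<omega> = the_inv_into {0..1} h"
  have cont\<omega>: "continuous_on {0..a} \<omega>"
    using continuous_on_inv_into[OF conth _ inj] by (simp add: im \<omega>_def)
  have h\<omega>: "h (\<omega> t) = t" if "t \<in> {0..a}" for t
    unfolding \<omega>_def by (rule f_the_inv_into_f[OF inj]) (use that im in simp)
  have \<omega>01: "\<omega> t \<in> {0..1}" if "t \<in> {0..a}" for t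
    unfolding \<omega>_def by (rule the_inv_into_into[OF inj]) (use that im in auto)
  have \<omega>0: "\<omega> 0 = 0" unfolding \<omega>_def using the_inv_into_f_f[OF inj, of 0] by (simp add: h0)
  have \<omega>a: "\<omega> a = 1" unfolding \<omega>_def using the_inv_into_f_f[OF inj, of 1] by (simp add: a_def)
  define n where "n t = p - 1 + \<omega> t powr p" for t
  have npos: "n t > 0" for t using p by (simp add: n_def add_pos_nonneg)
  have nz: "n t \<noteq> 0" for t using npos[of t] by simp
  have \<omega>int: "\<omega> t > 0" "\<omega> t < 1" if "t \<in> {0<..<a}" for t
    using h\<omega>[of t] \<omega>01[of t] that h0 a_def by (smt (verit) atLeastAtMost_iff greaterThanLessThan_iff)+
  have d\<omega>: "(\<omega> has_real_derivative n t / (p - 1)) (at t)" if t: "t \<in> {0<..<a}" for t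
  proof -
    have "(h has_real_derivative \<kappa> (\<omega> t)) (at (\<omega> t))"
      using h[of "\<omega> t"] \<omega>int[OF t] by (simp add: at_within_Icc_at)
    moreover have "isCont \<omega> t"
      using cont\<omega> t by (intro continuous_on_interior[of "{0..a}"]) auto
    moreover have "\<kappa> (\<omega> t) \<noteq> 0" using pos[of "\<omega> t"] by (simp add: \<kappa>_def)
    ultimately have "(\<omega> has_real_derivative inverse (\<kappa> (\<omega> t))) (at t)"
      using t h\<omega> by (intro DERIV_inverse_function[where f = h and g = \<omega> and x = t and a = 0 and b = a]) auto
    moreover have "inverse (\<kappa> (\<omega> t)) = n t / (p - 1)"
      using p by (simp add: \<kappa>_def n_def field_simps)
    ultimately show ?thesis by simp
  qed
  \<comment> \<open>Substituting \<open>\<sigma> = \<omega> * P\<close> into the first integral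
    gives \<open>P powr p * n = p\<close>. The constant \<open>p\<close> is chosen so that
    \<open>\<sigma>\<close> and \<open>P\<close> both equal 1 at \<open>a\<close>, where
    \<open>n a = p\<close>.\<close>
  define P where "P t = (p / n t) powr (1 / p)" for t
  define \<sigma> where "\<sigma> t = \<omega> t * P t" for t
  have Ppos: "P t > 0" for t using npos[of t] p by (simp add: P_def)
  have contn: "continuous_on {0..a} n"
    unfolding n_def using p \<omega>01
    by (intro continuous_on_add continuous_on_powr' cont\<omega> continuous_on_const) auto
  have contP: "continuous_on {0..a} P"
    unfolding P_def using p by (intro continuous_intros contn) (auto simp: nz)
  have dn: "(n has_real_derivative (p * \<omega> t powr (p - 1)) * (n t / (p - 1))) (at t)"
    if t: "t \<in> {0<..<a}" for t
    unfolding n_def[abs_def]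
    by (auto intro!: derivative_eq_intros d\<omega>[OF t, unfolded n_def] \<omega>int[OF t])
  have dP: "(P has_real_derivative - (P t * \<omega> t powr (p - 1) / (p - 1))) (at t)"
    if t: "t \<in> {0<..<a}" for t
  proof -
    have eq: "P = (\<lambda>t. exp ((ln p - ln (n t)) / p))"
      using p by (auto simp: P_def powr_def ln_div fun_eq_iff npos nz)
    show ?thesis
      unfolding eq using npos[of t] p by (auto intro!: derivative_eq_intros dn[OF t])
  qed
  have d\<sigma>: "(\<sigma> has_real_derivative P t) (at t)" if t: "t \<in> {0<..<a}" for t
  proof -
    have "\<omega> t powr p = \<omega> t * \<omega> t powr (p - 1)"
      using \<omega>int[OF t] by (simp add: powr_diff)
    then have "P t * (n t / (p - 1)) - \<omega> t * (P t * \<omega> t powr (p - 1) / (p - 1))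
        = P t * ((n t - \<omega> t powr p) / (p - 1))"
      by (simp add: right_diff_distrib diff_divide_distrib mult_ac)
    also have "\<dots> = P t" using p by (simp add: n_def)
    finally have "P t * (n t / (p - 1)) - \<omega> t * (P t * \<omega> t powr (p - 1) / (p - 1)) = P t" .
    then show ?thesis unfolding \<sigma>_def
      by (auto intro!: derivative_eq_intros dP[OF t] d\<omega>[OF t] simp: mult.commute)
  qed
  have dPp: "((\<lambda>t. P t powr (p - 1)) has_real_derivative - (\<sigma> t powr (p - 1))) (at t)"
    if t: "t \<in> {0<..<a}" for t
  proof -
    have "P t powr (p - 1) = P t * P t powr (p - 1 - 1)"
      using Ppos[of t] by (simp add: powr_diff power2_eq_square)
    then show ?thesis
      using p Ppos[of t] \<omega>int[OF t]
      by (auto intro!: derivative_eq_intros dP[OF t] simp: \<sigma>_def powr_mult)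
  qed
  have cont\<sigma>: "continuous_on {0..a} \<sigma>"
    unfolding \<sigma>_def by (intro continuous_intros cont\<omega> contP)
  have Pa: "P a = 1" using p by (simp add: P_def n_def \<omega>a)
  \<comment> \<open>By the Euler-Lagrange equation \<open>\<sigma> * P powr (p - 1)\<close> is an
    antiderivative of the integrand. It vanishes at 0 and equals 1 at \<open>a\<close>.\<close>
  have F: "((\<lambda>t. P t powr p - \<sigma> t powr p) has_integral \<sigma> a * P a powr (p - 1) - \<sigma> 0 * P 0 powr (p - 1)) {0..a}"
  proof (rule fundamental_theorem_of_calculus_interior)
    show "continuous_on {0..a} (\<lambda>t. \<sigma> t * P t powr (p - 1))"
      using Ppos p by (intro continuous_intros cont\<sigma> contP) (auto simp: less_imp_neq[OF Ppos, symmetric])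
    fix t assume t: "t \<in> {0<..<a}"
    have "P t * P t powr (p - 1) = P t powr p" "\<sigma> t * \<sigma> t powr (p - 1) = \<sigma> t powr p"
      using Ppos[of t] \<omega>int[OF t] by (auto simp: powr_diff \<sigma>_def)
    then show "((\<lambda>t. \<sigma> t * P t powr (p - 1)) has_vector_derivative P t powr p - \<sigma> t powr p) (at t)"
      unfolding has_real_derivative_iff_has_vector_derivative[symmetric]
      using DERIV_mult[OF d\<sigma>[OF t] dPp[OF t]] by (simp add: mult.commute)
  qed (use a0 in simp)
  have \<sigma>0: "\<sigma> 0 = 0" and \<sigma>a: "\<sigma> a = 1" by (simp_all add: \<sigma>_def \<omega>0 \<omega>a Pa)
  show ?thesis
  proof (rule that[of a \<sigma> P])
    show "((\<lambda>w. 1 / (1 + w powr p / (p - 1))) has_integral a) {0..1}"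
      using int[of 0 1] unfolding \<kappa>_def[abs_def] by (simp add: h0 a_def)
    show "0 \<le> \<sigma> t \<and> \<sigma> t \<le> P t \<and> 0 < P t" if "t \<in> {0..a}" for t
      using \<omega>01[OF that] Ppos[of t] by (auto simp: \<sigma>_def mult_le_cancel_right1)
    show "((\<lambda>t. P t powr p - \<sigma> t powr p) has_integral 1) {0..a}"
      using F by (simp add: \<sigma>0 \<sigma>a Pa)
  qed (fact a0 cont\<sigma> contP \<sigma>0 \<sigma>a Pa d\<sigma> dPp)+
qed

text \<open>Both integrals run over the same variable, so they can be compared pointwise. Since
  \<open>q - 1 = 1 / (p - 1)\<close>, \<open>conjugate_inverse_sum_le\<close> with
  \<open>k = p - 1\<close> bounds the sum of the integrands by \<open>2 / (1 + w\<^sup>2)\<close>,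
  whose integral is \<open>2 * arctan 1\<close>.\<close>

lemma conjugate_integrals_le_half_pi:
  fixes p q a b :: real
  assumes p: "p > 1" and q: "q = p / (p - 1)"
    and a: "((\<lambda>w. 1 / (1 + w powr p / (p - 1))) has_integral a) {0..1}"
    and b: "((\<lambda>w. 1 / (1 + w powr q / (q - 1))) has_integral b) {0..1}"
  shows "a + b \<le> pi / 2"
proof -
  have "((\<lambda>w. 2 / (1 + w\<^sup>2)) has_integral 2 * arctan 1 - 2 * arctan 0) {0..1::real}"
  proof (rule fundamental_theorem_of_calculus)
    fix x :: real
    show "((\<lambda>x. 2 * arctan x) has_vector_derivative 2 / (1 + x\<^sup>2)) (at x within {0..1})"
      unfolding has_real_derivative_iff_has_vector_derivative[symmetric]
      by (auto intro!: derivative_eq_intros simp: field_simps)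
  qed simp
  then have "((\<lambda>w. 2 / (1 + w\<^sup>2)) has_integral pi / 2) {0..1::real}"
    by (simp add: arctan_one)
  with has_integral_add[OF a b] show ?thesis
  proof (rule has_integral_le)
    fix w :: real assume w: "w \<in> {0..1}"
    have "q = 1 + 1 / (p - 1)" "w powr q / (q - 1) = (p - 1) * w powr q" using p by (auto simp: q field_simps)
    with conjugate_inverse_sum_le[of "p - 1" w] p w
    show "1 / (1 + w powr p / (p - 1)) + 1 / (1 + w powr q / (q - 1)) \<le> 2 / (1 + w\<^sup>2)"
      by (simp add: add.commute mult.commute)
  qed
qed

section \<open>Exponential decay from a weighted Hardy inequality\<close>

lemma continuous_on_if3:
  fixes f g h :: "real \<Rightarrow> 'a::topological_space"
  assumes "continuous_on {a..b} f" "continuous_on {b..c} g" "continuous_on {c..d} h"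
    and "f b = g b" "g c = h c" "b \<le> c"
  shows "continuous_on {a..d} (\<lambda>t. if t \<le> b then f t else if t \<le> c then g t else h t)"
proof (rule continuous_on_cases_le[where h = "\<lambda>x. x" and a = b])
  show "continuous_on {x \<in> {a..d}. x \<le> b} f"
    using assms(1) by (rule continuous_on_subset) auto
  have *: "continuous_on {b..d} (\<lambda>t. if t \<le> c then g t else h t)"
  proof (rule continuous_on_cases_le[where h = "\<lambda>x. x" and a = c])
    show "continuous_on {x \<in> {b..d}. x \<le> c} g"
      using assms(2) by (rule continuous_on_subset) auto
    show "continuous_on {x \<in> {b..d}. c \<le> x} h"
      using assms(3) by (rule continuous_on_subset) auto
  qed (use assms in auto)
  show "continuous_on {x \<in> {a..d}. b \<le> x} (\<lambda>t. if t \<le> c then g t else h t)"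
    using * by (rule continuous_on_subset) auto
qed (use assms in auto)

text \<open>
  In the last piece of the test function, \<open>(c \<phi>')\<^sup>p\<^sup>-\<^sup>1\<close> run backwards in time is the generalized
  sine for the conjugate exponent \<open>q\<close>, which avoids the singularity of the sine for \<open>p\<close> at its maximum.
\<close>

lemma decay_from_weighted_Hardy:
  fixes f :: "real \<Rightarrow> real" and p c T :: real
  assumes p: "p > 1" and c: "c > 0" and T: "T \<ge> 0"
    and contf: "continuous_on {0..T} f"
    and anti: "\<And>s t. 0 \<le> s \<Longrightarrow> s \<le> t \<Longrightarrow> t \<le> T \<Longrightarrow> f t \<le> f s"
    and nonneg: "f T \<ge> 0"
    and Hardy: "\<And>\<phi> \<psi> S. continuous_on {0..T} \<phi> \<Longrightarrow> continuous_on {0..T} \<psi> \<Longrightarrow>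
      (\<And>t. t \<in> {0..T} \<Longrightarrow> 0 \<le> \<phi> t \<and> 0 \<le> \<psi> t) \<Longrightarrow> \<phi> 0 = 0 \<Longrightarrow> finite S \<Longrightarrow>
      (\<And>t. t \<in> {0<..<T} - S \<Longrightarrow> (\<phi> has_real_derivative \<psi> t / c) (at t)) \<Longrightarrow>
      integral {0..T} (\<lambda>t. (\<phi> t powr p - \<psi> t powr p) * f t powr p) \<le> 0"
  shows "f T \<le> f 0 * exp (- T / c + pi / 2)"
proof -
  define q where "q = p / (p - 1)"
  have q: "q > 1" and pq: "(q - 1) * p = q" using p by (auto simp: q_def field_simps)
  obtain a \<sigma> P where a: "((\<lambda>w. 1 / (1 + w powr p / (p - 1))) has_integral a) {0..1}" and a0: "0 < a"
    and cont\<sigma>: "continuous_on {0..a} \<sigma>" and contP: "continuous_on {0..a} P"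
    and \<sigma>0: "\<sigma> 0 = 0" and \<sigma>a: "\<sigma> a = 1" and Pa: "P a = 1"
    and \<sigma>P: "\<And>t. t \<in> {0..a} \<Longrightarrow> 0 \<le> \<sigma> t \<and> \<sigma> t \<le> P t \<and> 0 < P t"
    and d\<sigma>: "\<And>t. t \<in> {0<..<a} \<Longrightarrow> (\<sigma> has_real_derivative P t) (at t)"
    and "\<And>t. t \<in> {0<..<a} \<Longrightarrow>
          ((\<lambda>t. P t powr (p - 1)) has_real_derivative - (\<sigma> t powr (p - 1))) (at t)"
    and int\<sigma>: "((\<lambda>t. P t powr p - \<sigma> t powr p) has_integral 1) {0..a}"
    by (rule generalized_sine[OF p]) blast
  obtain b \<rho> Q where b: "((\<lambda>w. 1 / (1 + w powr q / (q - 1))) has_integral b) {0..1}" and b0: "0 < b"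
    and cont\<rho>: "continuous_on {0..b} \<rho>" and contQ: "continuous_on {0..b} Q"
    and \<rho>0: "\<rho> 0 = 0" and \<rho>b: "\<rho> b = 1" and Qb: "Q b = 1"
    and \<rho>Q: "\<And>t. t \<in> {0..b} \<Longrightarrow> 0 \<le> \<rho> t \<and> \<rho> t \<le> Q t \<and> 0 < Q t"
    and "\<And>t. t \<in> {0<..<b} \<Longrightarrow> (\<rho> has_real_derivative Q t) (at t)"
    and dQ: "\<And>t. t \<in> {0<..<b} \<Longrightarrow>
          ((\<lambda>t. Q t powr (q - 1)) has_real_derivative - (\<rho> t powr (q - 1))) (at t)"
    and int\<rho>: "((\<lambda>t. Q t powr q - \<rho> t powr q) has_integral 1) {0..b}"
    by (rule generalized_sine[OF q]) blast
  have ab: "a + b \<le> pi / 2"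
    using conjugate_integrals_le_half_pi[OF p q_def a b] .
  have f0: "f 0 \<ge> 0" using anti[of 0 T] T nonneg by simp
  show ?thesis
  proof (cases "T \<le> (a + b) * c")
    \<comment> \<open>There is no room for both sine pieces, but then the exponent on the right is
      nonnegative and monotonicity of \<open>f\<close> suffices.\<close>
    case True
    then have "T / c \<le> a + b" using c by (simp add: field_simps)
    then have "- (T / c) + pi / 2 \<ge> 0" using ab by linarith
    then have "exp (- T / c + pi / 2) \<ge> 1" by simp
    then have "f 0 * 1 \<le> f 0 * exp (- T / c + pi / 2)" using f0 by (rule mult_left_mono)
    then show ?thesis using anti[of 0 T] T by simp
  next
    case False
    \<comment> \<open>The sine pieces occupy the first \<open>a * c\<close> and the last
      \<open>b * c\<close> units of time. \<open>Y\<close> is the value at \<open>t2\<close> of the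
      exponential that starts from 1 at \<open>t1\<close>; scaling the last piece by it makes the
      pieces match.\<close>
    define t1 where "t1 = a * c"
    define t2 where "t2 = T - b * c"
    define Y where "Y = exp (T / c - a - b)"
    have ord: "0 < t1" "t1 < t2" "t2 < T" using False a0 b0 c by (auto simp: t1_def t2_def algebra_simps)
    have Y: "Y > 0" by (simp add: Y_def)
    define \<phi>1 \<psi>1 where "\<phi>1 t = \<sigma> (t / c)" and "\<psi>1 t = P (t / c)" for t
    define e where "e t = exp (t / c - a)" for t
    \<comment> \<open>Reversing time cancels the minus sign in the equation for
      \<open>Q powr (q - 1)\<close>, so the derivative of \<open>\<phi>2\<close> is
      \<open>\<psi>2 / c\<close>. Because \<open>(q - 1) * p = q\<close>, the \<open>p\<close>-th
      powers become \<open>Y powr p\<close> times \<open>q\<close>-th powers of \<open>Q\<close> and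
      \<open>\<rho>\<close>, whose integral is known.\<close>
    define \<phi>2 \<psi>2 where "\<phi>2 t = Y * Q ((T - t) / c) powr (q - 1)"
      and "\<psi>2 t = Y * \<rho> ((T - t) / c) powr (q - 1)" for t
    define \<phi> where "\<phi> t = (if t \<le> t1 then \<phi>1 t else if t \<le> t2 then e t else \<phi>2 t)" for t
    define \<psi> where "\<psi> t = (if t \<le> t1 then \<psi>1 t else if t \<le> t2 then e t else \<psi>2 t)" for t
    have im1: "t / c \<in> {0..a}" if "t \<in> {0..t1}" for t
      using that c by (auto simp: t1_def field_simps)
    have im1': "t / c \<in> {0<..<a}" if "t \<in> {0<..<t1}" for t
      using that c by (auto simp: t1_def field_simps)
    have im2: "(T - t) / c \<in> {0..b}" if "t \<in> {t2..T}" for t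
      using that c by (auto simp: t2_def field_simps)
    have im2': "(T - t) / c \<in> {0<..<b}" if "t \<in> {t2<..<T}" for t
      using that c by (auto simp: t2_def field_simps)
    have sub1: "(\<lambda>t. t / c) ` {0..t1} \<subseteq> {0..a}" using im1 by blast
    have sub2: "(\<lambda>t. (T - t) / c) ` {t2..T} \<subseteq> {0..b}" using im2 by blast
    have lin: "continuous_on A (\<lambda>t. t / c)" "continuous_on A (\<lambda>t. (T - t) / c)" for A
      using c by (intro continuous_intros; simp)+
    have c1: "continuous_on {0..t1} \<phi>1" "continuous_on {0..t1} \<psi>1"
      unfolding \<phi>1_def \<psi>1_def
      using continuous_on_compose2[OF cont\<sigma> lin(1) sub1] continuous_on_compose2[OF contP lin(1) sub1]
      by auto
    have ce: "continuous_on {t1..t2} e"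
      unfolding e_def using c by (intro continuous_intros) auto
    note continuous_on_compose2[OF cont\<rho> lin(2) sub2] continuous_on_compose2[OF contQ lin(2) sub2]
    then have c2: "continuous_on {t2..T} \<phi>2" "continuous_on {t2..T} \<psi>2"
      unfolding \<phi>2_def \<psi>2_def using q \<rho>Q im2
      by (intro continuous_on_mult continuous_on_const continuous_on_powr' ballI; fastforce)+
    have j1: "\<phi>1 t1 = e t1" "\<psi>1 t1 = e t1"
      using c by (auto simp: \<phi>1_def \<psi>1_def e_def t1_def \<sigma>a Pa)
    have j2: "e t2 = \<phi>2 t2" "e t2 = \<psi>2 t2"
      using c by (auto simp: \<phi>2_def \<psi>2_def e_def t2_def Y_def \<rho>b Qb diff_divide_distrib)
    have cont\<phi>: "continuous_on {0..T} \<phi>" and cont\<psi>: "continuous_on {0..T} \<psi>"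
      unfolding \<phi>_def \<psi>_def using ord
      by (intro continuous_on_if3 c1 ce c2 j1 j2; simp)+
    have d\<phi>: "(\<phi> has_real_derivative \<psi> t / c) (at t)" if t: "t \<in> {0<..<T} - {t1, t2}" for t
    proof -
      consider "t \<in> {0<..<t1}" | "t \<in> {t1<..<t2}" | "t \<in> {t2<..<T}" using t by force
      then show ?thesis
      proof cases
        case 1
        have "(\<phi>1 has_real_derivative \<psi>1 t / c) (at t)"
          unfolding \<phi>1_def \<psi>1_def using c DERIV_chain2[OF d\<sigma>[OF im1'[OF 1]] DERIV_cdivide[OF DERIV_ident]]
          by simp
        then have "(\<phi> has_real_derivative \<psi>1 t / c) (at t)"
          using 1 by (elim has_field_derivative_transform_within_open[where S = "{0<..<t1}"])
            (auto simp: \<phi>_def)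
        then show ?thesis using 1 by (simp add: \<psi>_def)
      next
        case 2
        have "(e has_real_derivative e t / c) (at t)"
          unfolding e_def using c by (auto intro!: derivative_eq_intros)
        then have "(\<phi> has_real_derivative e t / c) (at t)"
          using 2 by (elim has_field_derivative_transform_within_open[where S = "{t1<..<t2}"])
            (auto simp: \<phi>_def)
        then show ?thesis using 2 by (simp add: \<psi>_def)
      next
        case 3
        have "((\<lambda>t. Q ((T - t) / c) powr (q - 1)) has_real_derivative
            - (\<rho> ((T - t) / c) powr (q - 1)) * (- 1 / c)) (at t)"
          by (rule DERIV_chain2[where f = "\<lambda>t. Q t powr (q - 1)" and g = "\<lambda>t. (T - t) / c", OF dQ[OF im2'[OF 3]]]) (use c in \<open>auto intro!: derivative_eq_intros\<close>)
        then have "(\<phi>2 has_real_derivative \<psi>2 t / c) (at t)"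
          unfolding \<phi>2_def \<psi>2_def by (rule DERIV_cmult[THEN DERIV_cong]) simp
        then have "(\<phi> has_real_derivative \<psi>2 t / c) (at t)"
          using 3 ord by (elim has_field_derivative_transform_within_open[where S = "{t2<..<T}"])
            (auto simp: \<phi>_def)
        then show ?thesis using 3 ord by (simp add: \<psi>_def)
      qed
    qed
    have nn: "0 \<le> \<phi> t \<and> 0 \<le> \<psi> t" if "t \<in> {0..T}" for t
      using that Y \<sigma>P[OF im1, of t]
      by (auto simp: \<phi>_def \<psi>_def \<phi>1_def \<psi>1_def e_def \<phi>2_def \<psi>2_def)
    have \<phi>0: "\<phi> 0 = 0" using ord by (simp add: \<phi>_def \<phi>1_def \<sigma>0)
    define D where "D t = (\<phi> t powr p - \<psi> t powr p) * f t powr p" for t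
    have D0: "integral {0..T} D \<le> 0"
      unfolding D_def by (rule Hardy[where S = "{t1, t2}", OF cont\<phi> cont\<psi> nn \<phi>0 _ d\<phi>]) simp_all
    have fnn: "f t \<ge> 0" if "t \<in> {0..T}" for t
      using anti[of t T] nonneg that by auto
    have contD: "continuous_on {0..T} D"
      unfolding D_def using p nn fnn
      by (intro continuous_on_mult continuous_on_diff continuous_on_powr' cont\<phi> cont\<psi> contf
          continuous_on_const ballI) auto
    then have intD: "D integrable_on {u..v}" if "0 \<le> u" "v \<le> T" for u v
      using that by (intro integrable_continuous_real continuous_on_subset[OF contD]) auto
    have split: "integral {0..T} D = integral {0..t1} D + integral {t1..t2} D + integral {t2..T} D"
      using ord intD by (simp add: Henstock_Kurzweil_Integration.integral_combine)
    have I2: "integral {t1..t2} D = 0"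
    proof -
      have "integral {t1..t2} D = integral {t1..t2} (\<lambda>t. 0)"
        by (rule integral_cong) (auto simp: D_def \<phi>_def \<psi>_def j1)
      then show ?thesis by simp
    qed
    \<comment> \<open>Here \<open>\<phi> \<le> \<psi>\<close>, so \<open>D\<close> is at most 0, and
      replacing \<open>f\<close> by its largest value \<open>f 0\<close> gives a lower bound.
      Rescaling time by \<open>c\<close> turns the integral 1 of the sine piece into
      \<open>c\<close>.\<close>
    have I1: "integral {0..t1} D \<ge> - (c * f 0 powr p)"
    proof -
      have "((\<lambda>t. P (t / c) powr p - \<sigma> (t / c) powr p) has_integral c) {0..t1}"
        using has_integral_affinity[of "\<lambda>t. P t powr p - \<sigma> t powr p" 1 0 a "1 / c" 0] int\<sigma> c
        by (simp add: t1_def mult.commute[of a c])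
      then have "((\<lambda>t. (\<psi>1 t powr p - \<phi>1 t powr p) * (- (f 0 powr p))) has_integral
          c * (- (f 0 powr p))) {0..t1}"
        unfolding \<phi>1_def \<psi>1_def by (rule has_integral_mult_left)
      moreover have "(D has_integral integral {0..t1} D) {0..t1}"
        using intD[of 0 t1] ord by (simp add: integrable_integral)
      ultimately have "c * (- (f 0 powr p)) \<le> integral {0..t1} D"
      proof (rule has_integral_le)
        fix t assume t: "t \<in> {0..t1}"
        have "f t powr p \<le> f 0 powr p"
          using anti[of 0 t] fnn[of t] t ord p by (intro powr_mono2) auto
        moreover have "\<psi>1 t powr p - \<phi>1 t powr p \<ge> 0"
          using \<sigma>P[OF im1[OF t]] p unfolding \<phi>1_def \<psi>1_def by (simp add: powr_mono2)
        ultimately have "(\<psi>1 t powr p - \<phi>1 t powr p) * f t powr p \<le> (\<psi>1 t powr p - \<phi>1 t powr p) * f 0 powr p"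
          by (rule mult_left_mono)
        then show "(\<psi>1 t powr p - \<phi>1 t powr p) * - (f 0 powr p) \<le> D t"
          using t by (simp add: D_def \<phi>_def \<psi>_def algebra_simps)
      qed
      then show ?thesis by simp
    qed
    \<comment> \<open>Now the sign is opposite: \<open>\<rho> \<le> Q\<close> makes \<open>D\<close>
      nonnegative, so the lower bound comes from the smallest value \<open>f T\<close>.\<close>
    have I3: "integral {t2..T} D \<ge> c * (Y * f T) powr p"
    proof -
      have im: "(\<lambda>x. T - x * c) ` {0..b} = {t2..T}"
      proof (intro subset_antisym subsetI)
        show "t \<in> (\<lambda>x. T - x * c) ` {0..b}" if "t \<in> {t2..T}" for t
          using im2[OF that] c by (intro image_eqI[of _ _ "(T - t) / c"]) auto
      qed (use c in \<open>auto simp: t2_def\<close>)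
      have lin_eq: "(\<lambda>x. (1 / (- 1 / c)) *\<^sub>R x + - ((1 / (- 1 / c)) *\<^sub>R (T / c))) = (\<lambda>x. T - x * c)"
        "\<And>t. (- 1 / c) *\<^sub>R t + T / c = (T - t) / c"
        using c by (auto simp: fun_eq_iff field_simps)
      have "((\<lambda>t. Q ((T - t) / c) powr q - \<rho> ((T - t) / c) powr q) has_integral
          (1 / \<bar>- 1 / c\<bar> ^ DIM(real)) *\<^sub>R 1) {t2..T}"
        using has_integral_affinity[of "\<lambda>t. Q t powr q - \<rho> t powr q" 1 0 b "- 1 / c" "T / c"] int\<rho> c
        unfolding lin_eq box_real im by auto
      then have "((\<lambda>t. Q ((T - t) / c) powr q - \<rho> ((T - t) / c) powr q) has_integral c) {t2..T}"
        using c by simp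
      then have "((\<lambda>t. (Q ((T - t) / c) powr q - \<rho> ((T - t) / c) powr q) * (Y * f T) powr p) has_integral
          c * (Y * f T) powr p) {t2..T}"
        by (rule has_integral_mult_left)
      moreover have "(D has_integral integral {t2..T} D) {t2..T}"
        using intD[of t2 T] ord by (simp add: integrable_integral)
      ultimately show ?thesis
      proof (rule has_integral_le)
        fix t assume t: "t \<in> {t2..T}"
        define x y where "x = Q ((T - t) / c)" and "y = \<rho> ((T - t) / c)"
        have xy: "0 \<le> y" "y \<le> x" "0 < x" using \<rho>Q[OF im2[OF t]] by (auto simp: x_def y_def)
        have "\<phi> t = \<phi>2 t" "\<psi> t = \<psi>2 t" using t ord j2 by (auto simp: \<phi>_def \<psi>_def)
        moreover have "(Y * z powr (q - 1)) powr p = Y powr p * z powr q" for z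
          using Y by (simp add: powr_mult powr_powr pq)
        ultimately have "D t = (x powr q - y powr q) * (Y powr p * f t powr p)"
          by (simp add: D_def \<phi>2_def \<psi>2_def x_def[symmetric] y_def[symmetric] algebra_simps)
        moreover have "(Y * f T) powr p = Y powr p * f T powr p"
          using Y nonneg by (simp add: powr_mult)
        moreover have "f T powr p \<le> f t powr p"
          using anti[of t T] nonneg t ord p by (intro powr_mono2) auto
        moreover have "x powr q - y powr q \<ge> 0" using xy q by (simp add: powr_mono2)
        ultimately show "(Q ((T - t) / c) powr q - \<rho> ((T - t) / c) powr q) * (Y * f T) powr p \<le> D t"
          by (simp add: x_def[symmetric] y_def[symmetric] mult_left_mono)
      qed
    qed
    have "c * (Y * f T) powr p \<le> c * f 0 powr p" using D0 I1 I2 I3 split by linarith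
    then have "(Y * f T) powr p \<le> f 0 powr p" using c by simp
    then have "Y * f T \<le> f 0"
      using powr_less_mono2[of p "f 0" "Y * f T"] p f0 by (meson linorder_not_le less_trans zero_less_one)
    then have "f T \<le> f 0 * exp (- T / c + (a + b))"
      by (simp add: Y_def exp_diff exp_add exp_minus field_simps)
    also have "\<dots> \<le> f 0 * exp (- T / c + pi / 2)"
      using ab f0 by (intro mult_left_mono) auto
    finally show ?thesis .
  qed
qed

section \<open>Strong Bochner integrals and strong measurability of the test functions\<close>

text \<open>This covers the convolution integrals of the test inputs, whose integrands stay on the
  line through one fixed vector. Existence follows by multiplying scalar simple approximations of
  \<open>h\<close> by \<open>v\<close>. For uniqueness, any other approximating sequence is compared
  in mean with this one.\<close>

lemma strong_bochner_integral_scaleR: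
  fixes v :: "'a::real_normed_vector"
  assumes h: "integrable M h" and f: "\<And>s. s \<in> space M \<Longrightarrow> f s = h s *\<^sub>R v"
  shows "strong_bochner_integral M f = (LINT s|M. h s) *\<^sub>R v"
proof -
  have hm [measurable]: "h \<in> borel_measurable M" using h by simp
  obtain r where r: "\<And>i. Bochner_Integration.simple_bochner_integrable M (r i)"
    and rlim: "(\<lambda>i. \<integral>\<^sup>+ s. ennreal (norm (h s - r i s)) \<partial>M) \<longlonglongrightarrow> 0"
    and rint: "(\<lambda>i. Bochner_Integration.simple_bochner_integral M (r i)) \<longlonglongrightarrow> (LINT s|M. h s)"
    using has_bochner_integral_integrable[OF h] by (rule has_bochner_integral.cases) blast
  define t where "t i s = r i s *\<^sub>R v" for i s
  have t: "Bochner_Integration.simple_bochner_integrable M (t i)" for i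
    unfolding t_def by (rule simple_bochner_integrable_compose2[OF _ r r, where p = "\<lambda>a b. a *\<^sub>R v"]) simp
  have rm [measurable]: "r i \<in> borel_measurable M" for i
    using r by (auto intro: borel_measurable_simple_function elim: simple_bochner_integrable.cases)
  have "(\<integral>\<^sup>+ s. ennreal (norm (f s - t i s)) \<partial>M) = ennreal (norm v) * (\<integral>\<^sup>+ s. ennreal (norm (h s - r i s)) \<partial>M)" for i
  proof -
    have "(\<integral>\<^sup>+ s. ennreal (norm (f s - t i s)) \<partial>M) = (\<integral>\<^sup>+ s. ennreal (norm v) * ennreal (norm (h s - r i s)) \<partial>M)"
      by (rule nn_integral_cong)
        (simp add: f t_def scaleR_left_diff_distrib[symmetric] ennreal_mult[symmetric] mult.commute)
    then show ?thesis by (simp add: nn_integral_cmult)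
  qed
  then have tlim: "(\<lambda>i. \<integral>\<^sup>+ s. ennreal (norm (f s - t i s)) \<partial>M) \<longlonglongrightarrow> 0"
    using ennreal_tendsto_cmult[OF _ rlim, of "ennreal (norm v)"] by simp
  have "(\<lambda>i. Bochner_Integration.simple_bochner_integral M (t i)) = (\<lambda>i. Bochner_Integration.simple_bochner_integral M (r i) *\<^sub>R v)"
  proof
    fix i
    have "linear (\<lambda>a. a *\<^sub>R v)" by (rule linearI) (simp_all add: scaleR_left_distrib)
    from simple_bochner_integral_linear[OF this r[of i]]
    show "Bochner_Integration.simple_bochner_integral M (t i) = Bochner_Integration.simple_bochner_integral M (r i) *\<^sub>R v"
      unfolding t_def .
  qed
  then have tint: "(\<lambda>i. Bochner_Integration.simple_bochner_integral M (t i)) \<longlonglongrightarrow> (LINT s|M. h s) *\<^sub>R v"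
    using tendsto_scaleR[OF rint tendsto_const] by simp
  have sm: "strongly_measurable M f"
  proof -
    obtain F where F: "\<And>i. simple_function M (F i)" "\<And>s. s \<in> space M \<Longrightarrow> (\<lambda>i. F i s) \<longlonglongrightarrow> h s"
      using borel_measurable_implies_sequence_metric[OF hm, of 0] by blast
    have "simple_function M (\<lambda>s. F i s *\<^sub>R v)" for i
      by (rule simple_function_compose1[OF F(1), where g = "\<lambda>a. a *\<^sub>R v"])
    moreover have "AE s in M. (\<lambda>i. F i s *\<^sub>R v) \<longlonglongrightarrow> f s"
      using F(2) by (intro AE_I2) (auto simp: f intro!: tendsto_intros)
    ultimately show ?thesis unfolding strongly_measurable_def
      by (intro exI[of _ "\<lambda>i s. F i s *\<^sub>R v"]) auto
  qed
  have ex: "has_strong_bochner_integral M f ((LINT s|M. h s) *\<^sub>R v)"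
    unfolding has_strong_bochner_integral_def using sm t tlim tint by blast
  have uniq: "x = (LINT s|M. h s) *\<^sub>R v" if x: "has_strong_bochner_integral M f x" for x
  proof -
    obtain s where s: "\<And>i. Bochner_Integration.simple_bochner_integrable M (s i)"
      and slim: "(\<lambda>i. \<integral>\<^sup>+ y. ennreal (norm (f y - s i y)) \<partial>M) \<longlonglongrightarrow> 0"
      and sint: "(\<lambda>i. Bochner_Integration.simple_bochner_integral M (s i)) \<longlonglongrightarrow> x"
      using x unfolding has_strong_bochner_integral_def by blast
    \<comment> \<open>In a nonseparable space the difference of two measurable functions need not be
      Borel measurable. The norm is therefore handled separately for each of the finitely many
      values of \<open>s i\<close>, where it is a continuous function of the scalar
      \<open>h\<close>.\<close>
    have meas: "(\<lambda>y. ennreal (norm (f y - s i y))) \<in> borel_measurable M" for i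
    proof -
      have sf: "simple_function M (s i)" using s by (auto elim: simple_bochner_integrable.cases)
      then have "s i \<in> measurable M (count_space (s i ` space M))"
        by (intro measurable_count_space_extend[OF subset_UNIV _ measurable_simple_function]) auto
      moreover have "countable (s i ` space M)"
        using sf by (intro countable_finite) (simp add: simple_function_def)
      moreover have "(\<lambda>y. norm (h y *\<^sub>R v - z)) \<in> borel_measurable M" for z
      proof -
        have "continuous_on UNIV (\<lambda>a. norm (a *\<^sub>R v - z))" by (intro continuous_intros)
        from borel_measurable_continuous_onI[OF this] hm show ?thesis
          by (rule measurable_compose_rev)
      qed
      ultimately have "(\<lambda>y. norm (h y *\<^sub>R v - s i y)) \<in> borel_measurable M"
        using measurable_compose_countable'[of "s i ` space M" "\<lambda>z y. norm (h y *\<^sub>R v - z)" M borel "s i"] by blast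
      then have "(\<lambda>y. ennreal (norm (h y *\<^sub>R v - s i y))) \<in> borel_measurable M" by simp
      then show ?thesis by (subst measurable_cong) (auto simp: f)
    qed
    have meast: "(\<lambda>y. ennreal (norm (f y - t i y))) \<in> borel_measurable M" for i
    proof -
      have "(\<lambda>y. ennreal (norm (h y - r i y) * norm v)) \<in> borel_measurable M" by measurable
      then show ?thesis
        by (subst measurable_cong[where g = "\<lambda>y. ennreal (norm (h y - r i y) * norm v)"])
          (auto simp: f t_def scaleR_left_diff_distrib[symmetric])
    qed
    let ?s = "\<lambda>i. Bochner_Integration.simple_bochner_integral M (s i)"
    let ?t = "\<lambda>i. Bochner_Integration.simple_bochner_integral M (t i)"
    have le: "ennreal (norm (?s i - ?t i)) \<le>
      (\<integral>\<^sup>+ y. ennreal (norm (f y - s i y)) \<partial>M) + (\<integral>\<^sup>+ y. ennreal (norm (f y - t i y)) \<partial>M)" for i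
    proof -
      have d: "Bochner_Integration.simple_bochner_integrable M (\<lambda>y. s i y - t i y)"
        by (rule simple_bochner_integrable_compose2[OF _ s t, where p = "(-)"]) simp
      have "norm (?s i - ?t i) \<le> Bochner_Integration.simple_bochner_integral M (\<lambda>y. norm (s i y - t i y))"
        using simple_bochner_integral_norm_bound[OF d] simple_bochner_integral_diff[OF s t] by metis
      then have "ennreal (norm (?s i - ?t i)) \<le> ennreal (Bochner_Integration.simple_bochner_integral M (\<lambda>y. norm (s i y - t i y)))"
        by (rule ennreal_leI)
      also have "\<dots> = (\<integral>\<^sup>+ y. ennreal (norm (s i y - t i y)) \<partial>M)"
        by (rule simple_bochner_integral_eq_nn_integral)
          (auto intro!: simple_bochner_integrable_compose2[OF _ s t, where p = "\<lambda>a b. norm (a - b)"])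
      also have "\<dots> \<le> (\<integral>\<^sup>+ y. ennreal (norm (f y - s i y)) + ennreal (norm (f y - t i y)) \<partial>M)"
      proof (rule nn_integral_mono)
        fix y
        have "norm (s i y - t i y) \<le> norm (f y - s i y) + norm (f y - t i y)"
          by (metis norm_diff_triangle_le norm_minus_commute order_refl)
        then show "ennreal (norm (s i y - t i y)) \<le> ennreal (norm (f y - s i y)) + ennreal (norm (f y - t i y))"
          by (metis ennreal_leI ennreal_plus norm_ge_zero)
      qed
      also have "\<dots> = (\<integral>\<^sup>+ y. ennreal (norm (f y - s i y)) \<partial>M) + (\<integral>\<^sup>+ y. ennreal (norm (f y - t i y)) \<partial>M)"
        by (rule nn_integral_add[OF meas meast])
      finally show ?thesis .
    qed
    have "(\<lambda>i. ennreal (norm (?s i - ?t i))) \<longlonglongrightarrow> 0"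
      by (rule tendsto_sandwich[OF _ _ tendsto_const])
        (use le tendsto_add[OF slim tlim] in auto)
    then have "(\<lambda>i. norm (?s i - ?t i)) \<longlonglongrightarrow> 0" by (simp flip: ennreal_0)
    moreover have "(\<lambda>i. norm (?s i - ?t i)) \<longlonglongrightarrow> norm (x - (LINT s|M. h s) *\<^sub>R v)"
      by (intro tendsto_intros sint tint)
    ultimately have "norm (x - (LINT s|M. h s) *\<^sub>R v) = 0" by (rule LIMSEQ_unique[symmetric])
    then show ?thesis by simp
  qed
  have "(THE x. has_strong_bochner_integral M f x) = (LINT s|M. h s) *\<^sub>R v"
    using ex uniq by (rule the_equality)
  with ex show ?thesis unfolding strong_bochner_integral_def by metis
qed

text \<open>The approximations sample \<open>g\<close> at the grid point of mesh
  \<open>1 / (n + 1)\<close> just to the left of \<open>t\<close>, and converge by continuity. The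
  index \<open>- 1\<close> marks points outside \<open>{0..T}\<close>, where the value is 0.\<close>

lemma strongly_measurable_continuous_on_Icc:
  fixes g :: "real \<Rightarrow> 'a::real_normed_vector"
  assumes g: "continuous_on {0..T} g"
  shows "strongly_measurable (lebesgue_on {0..}) (\<lambda>t. if t \<in> {0..T} then g t else 0)"
proof -
  define k where "k n t = (if t \<in> {0..T} then \<lfloor>t * real (Suc n)\<rfloor> else - 1)" for n t
  define G where "G n j = (if j < 0 then 0 else g (real_of_int j / real (Suc n)))" for n j
  have sk: "simple_function (lebesgue_on {0..}) (k n)" for n
  proof -
    have "k n t \<in> {-1..\<lfloor>T * real (Suc n)\<rfloor>}" if "T \<ge> 0" for t
    proof (cases "t \<in> {0..T}")
      case True
      then have "\<lfloor>t * real (Suc n)\<rfloor> \<le> \<lfloor>T * real (Suc n)\<rfloor>" "0 \<le> \<lfloor>t * real (Suc n)\<rfloor>"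
        by (auto intro!: floor_mono mult_right_mono)
      moreover have "k n t = \<lfloor>t * real (Suc n)\<rfloor>" using True by (simp add: k_def)
      ultimately show ?thesis unfolding atLeastAtMost_iff by (intro conjI; linarith)
    next
      case False
      have "0 \<le> \<lfloor>T * real (Suc n)\<rfloor>" using that by simp
      moreover have "k n t = - 1" using False by (auto simp: k_def)
      ultimately show ?thesis unfolding atLeastAtMost_iff by (intro conjI; linarith)
    qed
    moreover have "k n t = -1" if "T < 0" for t using that by (auto simp: k_def)
    ultimately have "k n ` space (lebesgue_on {0..}) \<subseteq> {-1..max (- 1) \<lfloor>T * real (Suc n)\<rfloor>}"
      by (cases "T \<ge> 0") (fastforce simp: image_subset_iff)+
    then have "finite (k n ` space (lebesgue_on {0..}))" by (rule finite_subset) simp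
    moreover have "k n \<in> measurable (lebesgue_on {0..}) (count_space UNIV)"
    proof -
      have "k n \<in> measurable borel (count_space UNIV)" unfolding k_def by measurable
      then show ?thesis by (intro measurable_restrict_space1 measurable_completion) simp
    qed
    ultimately show ?thesis by (simp add: simple_function_eq_measurable)
  qed
  have "simple_function (lebesgue_on {0..}) (\<lambda>t. G n (k n t))" for n
    using simple_function_compose1[OF sk[of n], of "G n"] .
  moreover have "(\<lambda>n. G n (k n t)) \<longlonglongrightarrow> (if t \<in> {0..T} then g t else 0)" for t
  proof (cases "t \<in> {0..T}")
    case True
    define x where "x n = real_of_int \<lfloor>t * real (Suc n)\<rfloor> / real (Suc n)" for n
    have x: "x n \<le> t" "t - 1 / real (Suc n) \<le> x n" "0 \<le> x n" for n
    proof -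
      have *: "t * real (Suc n) - 1 \<le> real_of_int \<lfloor>t * real (Suc n)\<rfloor>" by linarith
      show "x n \<le> t" unfolding x_def by (subst pos_divide_le_eq) auto
      have "(t * real (Suc n) - 1) / real (Suc n) \<le> x n" unfolding x_def using * by (rule divide_right_mono) simp
      then show "t - 1 / real (Suc n) \<le> x n" by (simp add: diff_divide_distrib)
      show "0 \<le> x n" using True unfolding x_def by simp
    qed
    have "x \<longlonglongrightarrow> t"
    proof (rule tendsto_sandwich)
      show "(\<lambda>n. t - 1 / real (Suc n)) \<longlonglongrightarrow> t"
        using tendsto_diff[OF tendsto_const LIMSEQ_Suc[OF lim_1_over_n], of t] by simp
    qed (use x in auto)
    moreover have "eventually (\<lambda>n. x n \<in> {0..T}) sequentially" using x True by (intro always_eventually allI) (auto intro: order_trans)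
    ultimately have "(\<lambda>n. g (x n)) \<longlonglongrightarrow> g t"
      by (rule continuous_on_tendsto_compose[OF g _ True])
    moreover have "G n (k n t) = g (x n)" for n
    proof -
      have "\<not> \<lfloor>t * real (Suc n)\<rfloor> < 0" using True by (simp add: not_less)
      then show ?thesis using True by (simp add: G_def k_def x_def del: of_nat_Suc)
    qed
    ultimately show ?thesis using True by simp
  qed (auto simp: G_def k_def)
  ultimately show ?thesis unfolding strongly_measurable_def
    by (intro exI[of _ "\<lambda>n t. G n (k n t)"]) auto
qed

lemma nn_integral_lebesgue_on_Icc_continuous:
  fixes k :: "real \<Rightarrow> real"
  assumes "continuous_on {a..b} k" and "\<And>t. t \<in> {a..b} \<Longrightarrow> 0 \<le> k t"
  shows "(\<integral>\<^sup>+ t. ennreal (k t) \<partial>lebesgue_on {a..b}) = ennreal (integral {a..b} k)"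
proof -
  have i: "integrable (lebesgue_on {a..b}) k" by (rule continuous_imp_integrable_real[OF assms(1)])
  then have "(\<integral>\<^sup>+ t. ennreal (k t) \<partial>lebesgue_on {a..b}) = ennreal (LINT t|lebesgue_on {a..b}. k t)"
    using assms(2) by (intro nn_integral_eq_integral AE_I2) auto
  then show ?thesis using lebesgue_integral_eq_integral[OF i] by simp
qed

section \<open>The weighted Hardy inequality along an orbit\<close>

text \<open>The norm bound is tested on the input \<open>(\<psi> / c) *\<^sub>R S t x\<close>, cut
  off after \<open>T\<close>. The finite set \<open>A\<close> leaves room for test functions glued
  from several pieces, without a derivative at the junctions.\<close>

lemma weighted_Hardy:
  fixes S :: "real \<Rightarrow> ('a::complex_normed_vector \<Rightarrow>\<^sub>L 'a)" and c p T :: real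
  assumes p: "p > 1" and c: "c > 0" and T: "T \<ge> 0" and S: "C0_semigroup S"
    and K: "\<And>u. u \<in> Lp_space p \<Longrightarrow>
      K_plus S u \<in> Lp_space p \<and> Lp_norm p (K_plus S u) \<le> ennreal c * Lp_norm p u"
    and cont\<phi>: "continuous_on {0..T} \<phi>" and cont\<psi>: "continuous_on {0..T} \<psi>"
    and nonneg: "\<And>t. t \<in> {0..T} \<Longrightarrow> 0 \<le> \<phi> t \<and> 0 \<le> \<psi> t" and \<phi>0: "\<phi> 0 = 0" and A: "finite A"
    and deriv: "\<And>t. t \<in> {0<..<T} - A \<Longrightarrow> (\<phi> has_real_derivative \<psi> t / c) (at t)"
  shows "integral {0..T} (\<lambda>t. (\<phi> t powr p - \<psi> t powr p) * norm (S t x) powr p) \<le> 0"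
proof -
  have contS: "continuous_on {0..T} (\<lambda>t. S t x)"
    using S unfolding C0_semigroup_def by (auto intro: continuous_on_subset[of "{0..}"])
  define f where "f t = norm (S t x)" for t
  have contf: "continuous_on {0..T} f" unfolding f_def by (intro continuous_intros contS)
  define g where "g t = (\<psi> t / c) *\<^sub>R S t x" for t
  define u where "u t = (if t \<in> {0..T} then g t else 0)" for t
  have contg: "continuous_on {0..T} g"
    unfolding g_def using c by (intro continuous_intros contS cont\<psi>) auto
  \<comment> \<open>The semigroup law turns the integrand into a scalar function times
    \<open>S t x\<close>, and \<open>\<phi> 0 = 0\<close> identifies the scalar integral with
    \<open>\<phi> t\<close>.\<close>
  have Ku: "K_plus S u t = \<phi> t *\<^sub>R S t x" if t: "t \<in> {0..T}" for t
  proof -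
    have "S (t - s) (u s) = (\<psi> s / c) *\<^sub>R S t x" if "s \<in> space (lebesgue_on {0..t})" for s
    proof -
      have s: "0 \<le> s" "s \<le> t" using that by auto
      then have "S ((t - s) + s) = S (t - s) o\<^sub>L S s" using S unfolding C0_semigroup_def by (metis diff_ge_0_iff_ge)
      then show ?thesis using s t by (simp add: u_def g_def blinfun.scaleR_right)
    qed
    moreover have ct: "continuous_on {0..t} (\<lambda>s. \<psi> s / c)"
      using t c by (intro continuous_intros continuous_on_subset[OF cont\<psi>]) auto
    ultimately have 1: "K_plus S u t = (LINT s|lebesgue_on {0..t}. \<psi> s / c) *\<^sub>R S t x"
      unfolding K_plus_def by (intro strong_bochner_integral_scaleR continuous_imp_integrable_real)
    have 2: "(LINT s|lebesgue_on {0..t}. \<psi> s / c) = integral {0..t} (\<lambda>s. \<psi> s / c)"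
      by (intro lebesgue_integral_eq_integral continuous_imp_integrable_real ct) simp
    have 3: "((\<lambda>s. \<psi> s / c) has_integral \<phi> t - \<phi> 0) {0..t}"
    proof (rule fundamental_theorem_of_calculus_interior_strong[OF A])
      show "continuous_on {0..t} \<phi>" using t by (intro continuous_on_subset[OF cont\<phi>]) auto
      show "(\<phi> has_vector_derivative \<psi> s / c) (at s)" if "s \<in> {0<..<t} - A" for s
        unfolding has_real_derivative_iff_has_vector_derivative[symmetric]
        using that t by (intro deriv) auto
    qed (use t in simp)
    show ?thesis unfolding 1 2 integral_unique[OF 3] \<phi>0 by simp
  qed
  define I where "I = integral {0..T} (\<lambda>t. (\<psi> t / c) powr p * f t powr p)"
  define J where "J = integral {0..T} (\<lambda>t. \<phi> t powr p * f t powr p)"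
  have cont\<psi>f: "continuous_on {0..T} (\<lambda>t. (\<psi> t / c) powr p * f t powr p)"
    using p c nonneg
    by (intro continuous_on_mult continuous_on_powr' continuous_on_divide cont\<psi> contf continuous_on_const)
      (auto simp: f_def)
  have cont\<phi>f: "continuous_on {0..T} (\<lambda>t. \<phi> t powr p * f t powr p)"
    using p nonneg
    by (intro continuous_on_mult continuous_on_powr' cont\<phi> contf continuous_on_const)
      (auto simp: f_def)
  have I0: "I \<ge> 0" unfolding I_def
    by (intro integral_nonneg integrable_continuous_real cont\<psi>f) auto
  have J0: "J \<ge> 0" unfolding J_def
    by (intro integral_nonneg integrable_continuous_real cont\<phi>f) auto
  have restr: "(\<integral>\<^sup>+ t. h t * indicator {0..T} t \<partial>lebesgue_on {0..}) = (\<integral>\<^sup>+ t. h t \<partial>lebesgue_on {0..T})"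
    for h :: "real \<Rightarrow> ennreal"
  proof -
    have "(\<integral>\<^sup>+ t. h t * indicator {0..T} t \<partial>lebesgue_on {0..})
        = (\<integral>\<^sup>+ t. h t * indicator {0..T} t * indicator {0..} t \<partial>lebesgue)"
      by (rule nn_integral_restrict_space) simp
    also have "\<dots> = (\<integral>\<^sup>+ t. h t * indicator {0..T} t \<partial>lebesgue)"
      by (rule nn_integral_cong) (simp add: indicator_def)
    also have "\<dots> = (\<integral>\<^sup>+ t. h t \<partial>lebesgue_on {0..T})"
      by (rule nn_integral_restrict_space[symmetric]) simp
    finally show ?thesis .
  qed
  have "(\<integral>\<^sup>+ t. ennreal (norm (u t) powr p) \<partial>lebesgue_on {0..})
      = (\<integral>\<^sup>+ t. ennreal ((\<psi> t / c) powr p * f t powr p) * indicator {0..T} t \<partial>lebesgue_on {0..})"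
    using nonneg c p
    by (intro nn_integral_cong) (auto simp: u_def g_def f_def indicator_def powr_mult powr_divide)
  also have "\<dots> = ennreal I"
    unfolding restr I_def by (rule nn_integral_lebesgue_on_Icc_continuous[OF cont\<psi>f]) simp
  finally have Iu: "(\<integral>\<^sup>+ t. ennreal (norm (u t) powr p) \<partial>lebesgue_on {0..}) = ennreal I" .
  then have normu: "Lp_norm p u = ennreal (I powr (1 / p))"
    using I0 by (simp add: Lp_norm_def)
  have "u \<in> Lp_space p"
    unfolding Lp_space_def using strongly_measurable_continuous_on_Icc[OF contg] normu
    by (simp add: u_def[abs_def])
  from K[OF this] have KLp: "Lp_norm p (K_plus S u) < \<infinity>" and
    Kle: "Lp_norm p (K_plus S u) \<le> ennreal c * ennreal (I powr (1 / p))"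
    by (auto simp: normu Lp_space_def)
  define J' where "J' = (\<integral>\<^sup>+ t. ennreal (norm (K_plus S u t) powr p) \<partial>lebesgue_on {0..})"
  have J'fin: "J' \<noteq> \<infinity>" using KLp by (auto simp: Lp_norm_def J'_def Let_def)
  \<comment> \<open>\<open>K_plus S u\<close> is known only on \<open>{0..T}\<close>. That is
    enough, since its values beyond \<open>T\<close> can only enlarge \<open>J'\<close>.\<close>
  have "ennreal J = (\<integral>\<^sup>+ t. ennreal (\<phi> t powr p * f t powr p) * indicator {0..T} t \<partial>lebesgue_on {0..})"
    unfolding restr J_def by (rule nn_integral_lebesgue_on_Icc_continuous[OF cont\<phi>f, symmetric]) simp
  also have "\<dots> \<le> J'"
    unfolding J'_def using nonneg
    by (intro nn_integral_mono) (auto simp: Ku f_def indicator_def powr_mult)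
  finally have "J \<le> enn2real J'" using enn2real_mono[of "ennreal J" J'] J0 J'fin
    by (simp add: top.not_eq_extremum)
  then have "J powr (1 / p) \<le> enn2real J' powr (1 / p)" using J0 p by (intro powr_mono2) auto
  moreover have "ennreal (enn2real J' powr (1 / p)) \<le> ennreal (c * I powr (1 / p))"
    using Kle J'fin c by (simp add: Lp_norm_def J'_def[symmetric] ennreal_mult Let_def)
  then have "enn2real J' powr (1 / p) \<le> c * I powr (1 / p)" using c by simp
  ultimately have "J powr (1 / p) \<le> c * I powr (1 / p)" by linarith
  then have "(J powr (1 / p)) powr p \<le> (c * I powr (1 / p)) powr p" using p by (intro powr_mono2) auto
  then have "J \<le> c powr p * I" using p c I0 J0 by (simp add: powr_mult powr_powr)
  also have "c powr p * I = integral {0..T} (\<lambda>t. c powr p * ((\<psi> t / c) powr p * f t powr p))"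
    unfolding I_def by simp
  also have "\<dots> = integral {0..T} (\<lambda>t. \<psi> t powr p * f t powr p)"
    by (rule integral_cong) (use c nonneg in \<open>auto simp: powr_divide\<close>)
  finally have le: "J \<le> integral {0..T} (\<lambda>t. \<psi> t powr p * f t powr p)" .
  have "continuous_on {0..T} (\<lambda>t. \<psi> t powr p * f t powr p)"
    using p nonneg
    by (intro continuous_on_mult continuous_on_powr' cont\<psi> contf continuous_on_const)
      (auto simp: f_def)
  with cont\<phi>f have "integral {0..T} (\<lambda>t. \<phi> t powr p * f t powr p - \<psi> t powr p * f t powr p)
     = J - integral {0..T} (\<lambda>t. \<psi> t powr p * f t powr p)"
    unfolding J_def by (intro Henstock_Kurzweil_Integration.integral_diff integrable_continuous_real)
  with le show ?thesis by (simp add: f_def left_diff_distrib)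
qed

section \<open>Decay of the semigroup and passage to the optimal constant\<close>

text \<open>The estimate is made orbit by orbit: contractivity and the semigroup law make
  \<open>norm (S t x)\<close> nonincreasing in \<open>t\<close>, and \<open>weighted_Hardy\<close>
  supplies the integral inequality.\<close>

lemma contraction_semigroup_decay:
  fixes S :: "real \<Rightarrow> ('a::complex_normed_vector \<Rightarrow>\<^sub>L 'a)" and c p t :: real
  assumes p: "p > 1" and c: "c > 0" and t: "t \<ge> 0" and S: "C0_semigroup S"
    and contr: "\<forall>t\<ge>0. norm (S t) \<le> 1"
    and K: "\<And>u. u \<in> Lp_space p \<Longrightarrow>
      K_plus S u \<in> Lp_space p \<and> Lp_norm p (K_plus S u) \<le> ennreal c * Lp_norm p u"
  shows "norm (S t) \<le> exp (- t / c + pi / 2)"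
proof (rule norm_blinfun_bound)
  fix x
  have "norm (S t x) \<le> norm (S 0 x) * exp (- t / c + pi / 2)"
  proof (rule decay_from_weighted_Hardy[OF p c t])
    show "continuous_on {0..t} (\<lambda>t. norm (S t x))"
      using S unfolding C0_semigroup_def
      by (auto intro!: continuous_on_norm intro: continuous_on_subset[of "{0..}"])
    show "norm (S v x) \<le> norm (S u x)" if "0 \<le> u" "u \<le> v" for u v
    proof -
      have "S ((v - u) + u) = S (v - u) o\<^sub>L S u"
        using S that unfolding C0_semigroup_def by (metis diff_ge_0_iff_ge)
      then have "norm (S v x) \<le> norm (S (v - u)) * norm (S u x)"
        by (simp add: norm_blinfun)
      also have "\<dots> \<le> 1 * norm (S u x)"
        using contr that by (intro mult_right_mono) auto
      finally show ?thesis by simp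
    qed
  qed (use weighted_Hardy[OF p c t S K] in auto)
  then show "norm (S t x) \<le> exp (- t / c + pi / 2) * norm x"
    using S by (simp add: C0_semigroup_def mult.commute)
qed simp

theorem theorem4p6:
  fixes p :: real
    and S :: "real \<Rightarrow> ('a::{complex_normed_vector, banach} \<Rightarrow>\<^sub>L 'a)"
  assumes "p > 1"
    and "\<exists>x::'a. x \<noteq> 0"
    and "reflexive_space TYPE('a)"
    and "C0_semigroup S"
    and "\<forall>t\<ge>0. norm (S t) \<le> 1"
    and "r_hat p S > 0"
  shows "\<forall>t\<ge>0. norm (S t) \<le> exp (- enn2real (r_hat p S) * t + pi / 2)"
proof (intro allI impI)
  fix t :: real assume t: "t \<ge> 0"
  define k where "k = enn2real (K_norm p S)"
  have K: "K_norm p S = ennreal k"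
  proof -
    have "K_norm p S \<noteq> \<infinity>" using assms(6) by (auto simp: r_hat_def)
    then show ?thesis by (simp add: k_def top.not_eq_extremum)
  qed
  show "norm (S t) \<le> exp (- enn2real (r_hat p S) * t + pi / 2)"
  proof (cases "k = 0")
    \<comment> \<open>Then \<open>r_hat p S\<close> is infinite, which \<open>enn2real\<close> sends
      to 0, so the claimed bound is the constant \<open>exp (pi / 2)\<close>.\<close>
    case True
    then have "enn2real (r_hat p S) = 0" by (simp add: r_hat_def K)
    moreover have "norm (S t) \<le> exp (pi / 2)"
      using assms(5) t one_le_exp_iff[of "pi / 2"] pi_ge_zero by (meson divide_nonneg_pos order_trans zero_less_numeral)
    ultimately show ?thesis by simp
  next
    case False
    then have k: "k > 0" by (simp add: k_def less_le)
    then have r: "enn2real (r_hat p S) = 1 / k"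
      using divide_ennreal[of 1 k] by (simp add: r_hat_def K)
    \<comment> \<open>\<open>K_norm\<close> is an infimum, so \<open>k\<close> itself need not be an
      admissible constant. Every \<open>k + e\<close> lies above an admissible one, and
      \<open>e\<close> then tends to 0 along \<open>1 / real (Suc n)\<close>.\<close>
    have bound: "norm (S t) \<le> exp (- t / (k + e) + pi / 2)" if e: "e > 0" for e
    proof (rule contraction_semigroup_decay[OF assms(1) _ t assms(4,5)])
      show "k + e > 0" using k e by simp
      have "K_norm p S < ennreal (k + e)" using k e by (simp add: K)
      then obtain C where C: "C < ennreal (k + e)"
        and adm: "\<And>u. u \<in> Lp_space p \<Longrightarrow> K_plus S u \<in> Lp_space p \<and> Lp_norm p (K_plus S u) \<le> C * Lp_norm p u"
        unfolding K_norm_def Inf_less_iff by blast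
      show "K_plus S u \<in> Lp_space p \<and> Lp_norm p (K_plus S u) \<le> ennreal (k + e) * Lp_norm p u"
        if "u \<in> Lp_space p" for u
        using adm[OF that] mult_right_mono[OF less_imp_le[OF C], of "Lp_norm p u"] by (auto intro: order_trans)
    qed
    have "(\<lambda>n. exp (- t / (k + 1 / real (Suc n)) + pi / 2)) \<longlonglongrightarrow> exp (- t / (k + 0) + pi / 2)"
      using k by (intro tendsto_intros LIMSEQ_Suc[OF lim_1_over_n]) auto
    then have "norm (S t) \<le> exp (- t / (k + 0) + pi / 2)"
      using bound by (intro LIMSEQ_le_const) auto
    then show ?thesis by (simp add: r)
  qed
qed

end
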